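(* Fix $\alpha\in(0,1)$. Under no assumption on the data other than coherence of the observations, the hierarchical ellipsoidal split conformal procedure outputs prediction ellipsoids $\mathring{E}$ that are uniformly more efficient than the prediction ellipsoids $\check{E}$ output by the plain ellipsoidal split conformal procedure (both defined in the context, and run with the same regression algorithm $\mathcal{A}$, estimation procedure $\mathcal{E}$ and data partition): $$\forall x\in\mathbb{R}^d,\qquad \mathfrak{L}_m\bigl(\mathring{E}(x)\bigr)\ \leq\ \mathfrak{L}_m\bigl(\check{E}(x)\bigr).$$
   Context: Hierarchical data: let $m\geq 3$, $2\leq n<m$, $d\geq 1$, and let $H=\begin{bmatrix}\mathrm{Id}_n\\ H_{\mathrm{sub}}\end{bmatrix}$ be a fixed $m\times n$ real matrix, where $H_{\mathrm{sub}}$ is any $(m-n)\times n$ real matrix. The data are pairs $(x_t,y_t)$, $1\leq t\leq T$, with $x_t\in\mathbb{R}^d$ and $y_t\in\mathbb{R}^m$, where all observations are coherent: $y_t=H\,(y_{t,1},\ldots,y_{t,n})^\top$, i.e., $y_t\in\mathrm{Im}(H)$. $\mathfrak{L}_m$ is the Lebesgue measure on $\mathbb{R}^m$. For a symmetric positive definite matrix $A$, $\|u\|_A=\sqrt{u^\top A u}$. Common steps: $\{1,\ldots,T\}$ is partitioned into $\mathcal{D}_{\mathrm{train}},\mathcal{D}_{\mathrm{estim}},\mathcal{D}_{\mathrm{calib}}$, with $T_{\mathrm{calib}}$ the cardinality of $\mathcal{D}_{\mathrm{calib}}$. An arbitrary regression algorithm $\mathcal{A}$ outputs $\widehat{\mu}:\mathbb{R}^d\to\mathbb{R}^m$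 based on $(x_t,y_t)_{t\in\mathcal{D}_{\mathrm{train}}}$, and an arbitrary estimation procedure $\mathcal{E}$ outputs a symmetric positive definite $m\times m$ matrix $A$ based on $(x_t,y_t)_{t\in\mathcal{D}_{\mathrm{train}}\cup\mathcal{D}_{\mathrm{estim}}}$. Plain procedure: for $t\in\mathcal{D}_{\mathrm{calib}}$ let $\check{s}_t=\|y_t-\widehat{\mu}(x_t)\|_A$, order these into $\check{s}_{(1)}\leq\cdots\leq\check{s}_{(T_{\mathrm{calib}})}$, set $\check{s}_{(0)}=0$, $\check{s}_{(T_{\mathrm{calib}}+1)}=+\infty$, and let $\check{q}_{1-\alpha}=\check{s}_{(\lceil (T_{\mathrm{calib}}+1)(1-\alpha)\rceil)}$ and $\check{E}(x)=\{y\in\mathbb{R}^m:\|y-\widehat{\mu}(x)\|_A\leq\check{q}_{1-\alpha}\}$. Hierarchical procedure: let $P_A=H(H^\top AH)^{-1}H^\top A$ and $\mathring{\mu}(\cdot)=P_A\widehat{\mu}(\cdot)$; for $t\in\mathcal{D}_{\mathrm{calib}}$ let $\mathring{s}_t=\|y_t-\mathring{\mu}(x_t)\|_A$, order these into $\mathring{s}_{(1)}\leq\cdots\leq\mathring{s}_{(T_{\mathrm{calib}})}$, set $\mathring{s}_{(0)}=0$, $\mathring{s}_{(T_{\mathrm{calib}}+1)}=+\infty$, and let $\mathring{q}_{1-\alpha}=\mathring{s}_{(\lceil (T_{\mathrm{calib}}+1)(1-\alpha)\rceil)}$ and $\mathring{E}(x)=\{y\in\mathbb{R}^m:\|y-\mathring{\mu}(x)\|_A\leq\mathring{q}_{1-\alpha}\}$.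 *)

theory Defs
  imports "HOL-Analysis.Analysis"
begin

text \<open>
  The \<open>m = n + k\<close> components of an observation are indexed by the sum type \<open>'n + 'k\<close>:
  \<open>Inl\<close> indexes the first \<open>n\<close> components and \<open>Inr\<close> the \<open>m - n\<close> remaining ones.
  As \<open>'k\<close> is nonempty, \<open>n < m\<close> holds automatically.
\<close>

definition hier_matrix :: "real ^ 'n ^ 'k::finite \<Rightarrow> real ^ 'n ^ ('n + 'k)" where
  "hier_matrix H_sub = (\<chi> i. case i of Inl j \<Rightarrow> mat 1 $ j | Inr l \<Rightarrow> H_sub $ l)"

definition coherent :: "real ^ 'n ^ ('n + 'k::finite) \<Rightarrow> real ^ ('n + 'k) \<Rightarrow> bool" where
  "coherent H y \<longleftrightarrow> y = H *v (\<chi> j. y $ Inl j)"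

definition sym_pos_def :: "real ^ 'm ^ 'm \<Rightarrow> bool" where
  "sym_pos_def A \<longleftrightarrow> transpose A = A \<and> (\<forall>u. u \<noteq> 0 \<longrightarrow> 0 < u \<bullet> (A *v u))"

definition norm_wrt :: "real ^ 'm ^ 'm \<Rightarrow> real ^ 'm \<Rightarrow> real" where
  "norm_wrt A u = sqrt (u \<bullet> (A *v u))"

definition proj_wrt :: "real ^ 'n ^ 'm \<Rightarrow> real ^ 'm ^ 'm \<Rightarrow> real ^ 'm ^ 'm" where
  "proj_wrt H A = H ** matrix_inv (transpose H ** A ** H) ** transpose H ** A"

text \<open>
  A sample is a family of pairs \<open>(x\<^sub>t, y\<^sub>t)\<close> indexed by a set of times, represented as a map
  whose domain is that set, so that a procedure run on it has access to nothing else.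
\<close>

type_synonym ('x, 'y) sample = "nat \<rightharpoonup> 'x \<times> 'y"

definition sample_on :: "nat set \<Rightarrow> (nat \<Rightarrow> 'x) \<Rightarrow> (nat \<Rightarrow> 'y) \<Rightarrow> ('x, 'y) sample" where
  "sample_on D x y = (\<lambda>t. Some (x t, y t)) |` D"

text \<open>
  The \<open>k\<close>-th smallest value of the family \<open>(s\<^sub>t)\<close> for \<open>t \<in> D\<close>, counted with multiplicity, with
  the conventions \<open>0\<close> for \<open>k = 0\<close> and \<open>\<infinity>\<close> for \<open>k = card D + 1\<close>.
\<close>

definition order_stat :: "nat set \<Rightarrow> (nat \<Rightarrow> real) \<Rightarrow> nat \<Rightarrow> ereal" where
  "order_stat D s k =
     (if k = 0 then 0
      else if k \<le> card D then ereal (sorted_list_of_multiset (image_mset s (mset_set D)) ! (k - 1))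
      else \<infinity>)"

definition conformal_quantile :: "real \<Rightarrow> nat set \<Rightarrow> (nat \<Rightarrow> real) \<Rightarrow> ereal" where
  "conformal_quantile \<alpha> D s = order_stat D s (nat \<lceil>(real (card D) + 1) * (1 - \<alpha>)\<rceil>)"

definition calibrated_ellipsoid ::
  "real \<Rightarrow> nat set \<Rightarrow> (nat \<Rightarrow> 'x) \<Rightarrow> (nat \<Rightarrow> real ^ 'm) \<Rightarrow> ('x \<Rightarrow> real ^ 'm) \<Rightarrow> real ^ 'm ^ 'm
   \<Rightarrow> 'x \<Rightarrow> (real ^ 'm) set" where
  "calibrated_ellipsoid \<alpha> D_calib x y \<mu> A x' =
     {z. ereal (norm_wrt A (z - \<mu> x'))
           \<le> conformal_quantile \<alpha> D_calib (\<lambda>t. norm_wrt A (y t - \<mu> (x t)))}"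

definition plain_ellipsoid ::
  "(('x, real ^ 'm) sample \<Rightarrow> 'x \<Rightarrow> real ^ 'm) \<Rightarrow> (('x, real ^ 'm) sample \<Rightarrow> real ^ 'm ^ 'm)
   \<Rightarrow> real \<Rightarrow> nat set \<Rightarrow> nat set \<Rightarrow> nat set \<Rightarrow> (nat \<Rightarrow> 'x) \<Rightarrow> (nat \<Rightarrow> real ^ 'm)
   \<Rightarrow> 'x \<Rightarrow> (real ^ 'm) set" where
  "plain_ellipsoid \<A> \<E> \<alpha> D_train D_estim D_calib x y =
     (let \<mu> = \<A> (sample_on D_train x y);
          A = \<E> (sample_on (D_train \<union> D_estim) x y)
      in calibrated_ellipsoid \<alpha> D_calib x y \<mu> A)"

definition hier_ellipsoid ::
  "real ^ 'n ^ 'm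
   \<Rightarrow> (('x, real ^ 'm) sample \<Rightarrow> 'x \<Rightarrow> real ^ 'm) \<Rightarrow> (('x, real ^ 'm) sample \<Rightarrow> real ^ 'm ^ 'm)
   \<Rightarrow> real \<Rightarrow> nat set \<Rightarrow> nat set \<Rightarrow> nat set \<Rightarrow> (nat \<Rightarrow> 'x) \<Rightarrow> (nat \<Rightarrow> real ^ 'm)
   \<Rightarrow> 'x \<Rightarrow> (real ^ 'm) set" where
  "hier_ellipsoid H \<A> \<E> \<alpha> D_train D_estim D_calib x y =
     (let \<mu> = \<A> (sample_on D_train x y);
          A = \<E> (sample_on (D_train \<union> D_estim) x y)
      in calibrated_ellipsoid \<alpha> D_calib x y (\<lambda>x'. proj_wrt H A *v \<mu> x') A)"

end

theory Submission
  imports Defs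
begin

text \<open>
  The matrix \<open>P\<^sub>A\<close> is the projection onto \<open>Im(H)\<close> that is orthogonal for the inner product given
  by \<open>A\<close>. As coherent observations are fixed by \<open>P\<^sub>A\<close>, the hierarchical residuals are the images
  under \<open>P\<^sub>A\<close> of the plain ones, so every calibration score, and hence the calibrated radius, can
  only decrease. Both ellipsoids have the same shape up to a translation, and the Lebesgue measure
  is translation invariant.
\<close>

text \<open>In a sorted list the entries bounded by \<open>c\<close> form a prefix, and the 0-based
  position \<open>j\<close> lies in it exactly when \<open>j\<close> is below its length.\<close>

lemma sorted_nth_le_iff:
  fixes c :: "'a::linorder"
  assumes "sorted xs" "j < length xs"
  shows "xs ! j \<le> c \<longleftrightarrow> j < length (filter (\<lambda>x. x \<le> c) xs)"
  using assms
proof (induction xs arbitrary: j)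
  case Nil
  then show ?case by simp
next
  case (Cons a xs)
  show ?case
  proof (cases "a \<le> c")
    case True
    then show ?thesis using Cons by (cases j) auto
  next
    case False
    then have gt: "\<forall>x\<in>set (a # xs). c < x" using Cons.prems(1) by fastforce
    then have "filter (\<lambda>x. x \<le> c) (a # xs) = []" by (simp add: filter_empty_conv not_le)
    moreover have "c < (a # xs) ! j" using gt Cons.prems(2) nth_mem by blast
    ultimately show ?thesis by (metis less_zeroE list.size(3) not_le)
  qed
qed

text \<open>This turns bounds on order statistics into counts of indices, so that two score families
  can be compared although they may be sorted in different orders.\<close>

lemma nth_sorted_image_mset_le_iff:
  fixes s :: "'b \<Rightarrow> 'a::linorder"
  assumes "finite D" "j < card D"
  shows "sorted_list_of_multiset (image_mset s (mset_set D)) ! j \<le> c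
         \<longleftrightarrow> j < card {t \<in> D. s t \<le> c}"
proof -
  define xs where "xs = sorted_list_of_multiset (image_mset s (mset_set D))"
  have mset_xs: "mset xs = image_mset s (mset_set D)" by (simp add: xs_def)
  have "length xs = card D" by (metis mset_xs size_mset size_image_mset size_mset_set)
  moreover have "length (filter (\<lambda>x. x \<le> c) xs) = card {t \<in> D. s t \<le> c}"
  proof -
    have "length (filter (\<lambda>x. x \<le> c) xs) = size (filter_mset (\<lambda>x. x \<le> c) (mset xs))"
      by (metis mset_filter size_mset)
    also have "\<dots> = card {t \<in> D. s t \<le> c}"
      using assms(1) by (simp add: mset_xs filter_mset_image_mset)
    finally show ?thesis .
  qed
  moreover have "sorted xs" by (simp add: xs_def)
  ultimately show ?thesis using sorted_nth_le_iff[of xs j c] assms(2) by (simp add: xs_def)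
qed

lemma order_stat_mono:
  assumes "finite D" and le: "\<And>t. t \<in> D \<Longrightarrow> s t \<le> s' t"
  shows "order_stat D s k \<le> order_stat D s' k"
\<comment> \<open>The conventional values 0 and \<infinity> do not depend on the scores.\<close>
proof (cases "k = 0 \<or> card D < k")
  case True
  then show ?thesis by (auto simp: order_stat_def)
next
  case False
  \<comment> \<open>The threshold is the order statistic of the larger family itself, so the trivial
    bound \<open>c \<le> c\<close> yields the count below.\<close>
  define c where "c = sorted_list_of_multiset (image_mset s' (mset_set D)) ! (k - 1)"
  have k: "k - 1 < card D" using False by auto
  then have "k - 1 < card {t \<in> D. s' t \<le> c}"
    using nth_sorted_image_mset_le_iff[OF assms(1) k, of s' c] by (simp add: c_def)
  also have "\<dots> \<le> card {t \<in> D. s t \<le> c}"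
    using le assms(1) by (intro card_mono) (auto intro: order_trans)
  finally have "sorted_list_of_multiset (image_mset s (mset_set D)) ! (k - 1) \<le> c"
    using nth_sorted_image_mset_le_iff[OF assms(1) k] by blast
  then show ?thesis using False by (simp add: order_stat_def c_def)
qed

lemma conformal_quantile_mono:
  assumes "finite D" "\<And>t. t \<in> D \<Longrightarrow> s t \<le> s' t"
  shows "conformal_quantile \<alpha> D s \<le> conformal_quantile \<alpha> D s'"
  unfolding conformal_quantile_def by (rule order_stat_mono[OF assms])

text \<open>A kernel vector \<open>v\<close> makes the \<open>A\<close>-norm of
  \<open>H *v v\<close> vanish, so positive definiteness and injectivity force \<open>v = 0\<close>;
  a square matrix with trivial kernel is invertible.\<close>

lemma invertible_gram_if_sym_pos_def:
  fixes H :: "real ^ 'n ^ 'm"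
  assumes "sym_pos_def A" and inj: "inj ((*v) H)"
  shows "invertible (transpose H ** A ** H)"
proof -
  have "v = 0" if v: "(transpose H ** A ** H) *v v = 0" for v
  proof -
    have "(H *v v) \<bullet> (A *v (H *v v)) = v \<bullet> ((transpose H ** A ** H) *v v)"
      by (metis dot_lmul_matrix inner_commute matrix_vector_mul_assoc vector_transpose_matrix transpose_transpose)
    then have "H *v v = 0" using v assms(1) unfolding sym_pos_def_def by force
    then show "v = 0" using inj by (metis injD matrix_vector_mult_0_right)
  qed
  then show ?thesis by (simp add: invertible_left_inverse matrix_left_invertible_ker)
qed

lemma
  fixes B :: "'a::semiring_1 ^ 'n ^ 'm"
  assumes "invertible B"
  shows matrix_inv_right: "B ** matrix_inv B = mat 1"
    and matrix_inv_left: "matrix_inv B ** B = mat 1"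
  using someI_ex[OF assms[unfolded invertible_def]] by (simp_all add: matrix_inv_def)

lemma proj_wrt_mult_vec:
  "proj_wrt H A *v u = H *v (matrix_inv (transpose H ** A ** H) *v (transpose H *v (A *v u)))"
  by (simp add: proj_wrt_def flip: matrix_vector_mul_assoc)

lemma proj_wrt_fixes_range:
  assumes "invertible (transpose H ** A ** H)"
  shows "proj_wrt H A *v (H *v v) = H *v v"
proof -
  let ?B = "transpose H ** A ** H"
  have "transpose H *v (A *v (H *v v)) = ?B *v v"
    by (simp flip: matrix_vector_mul_assoc)
  then show ?thesis
    by (simp add: proj_wrt_mult_vec matrix_vector_mul_assoc[of _ ?B] matrix_inv_left[OF assms])
qed

text \<open>These are the normal equations of weighted least squares: cancelling the Gram matrix
  against its inverse shows that \<open>transpose H ** A\<close> annihilates the residual.\<close>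

lemma proj_wrt_orthogonal:
  assumes "invertible (transpose H ** A ** H)"
  shows "(H *v w) \<bullet> (A *v (u - proj_wrt H A *v u)) = 0"
proof -
  let ?B = "transpose H ** A ** H"
  let ?g = "transpose H *v (A *v u)"
  have "transpose H *v (A *v (proj_wrt H A *v u)) = ?B *v (matrix_inv ?B *v ?g)"
    by (simp add: proj_wrt_mult_vec flip: matrix_vector_mul_assoc)
  also have "\<dots> = ?g"
    by (simp add: matrix_vector_mul_assoc[of ?B] matrix_inv_right[OF assms])
  finally have "transpose H *v (A *v (u - proj_wrt H A *v u)) = 0"
    by (simp add: matrix_vector_mult_diff_distrib)
  moreover have "(H *v w) \<bullet> z = w \<bullet> (transpose H *v z)" for z
    by (metis dot_lmul_matrix vector_transpose_matrix transpose_transpose)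
  ultimately show ?thesis by simp
qed

text \<open>Pythagoras for the inner product given by \<open>A\<close>: the squared norm of
  \<open>u\<close> is that of its projection plus that of the residual.\<close>

lemma norm_wrt_proj_wrt_le:
  assumes A: "sym_pos_def A" and "invertible (transpose H ** A ** H)"
  shows "norm_wrt A (proj_wrt H A *v u) \<le> norm_wrt A u"
proof -
  define p where "p = proj_wrt H A *v u"
  define r where "r = u - p"
  \<comment> \<open>By \<open>proj_wrt_mult_vec\<close>, \<open>p\<close> has the form
    \<open>H *v w\<close>, so the normal equations apply to it.\<close>
  have pr: "p \<bullet> (A *v r) = 0"
    using proj_wrt_orthogonal[OF assms(2)] unfolding p_def r_def by (metis proj_wrt_mult_vec)
  have sym: "transpose A = A" using A by (simp add: sym_pos_def_def)
  have rp: "r \<bullet> (A *v p) = 0"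
    using pr by (metis sym dot_lmul_matrix inner_commute vector_transpose_matrix)
  have r: "0 \<le> r \<bullet> (A *v r)"
    using A unfolding sym_pos_def_def by (cases "r = 0") (auto intro: less_imp_le)
  have "u = p + r" by (simp add: r_def)
  then have "u \<bullet> (A *v u) = p \<bullet> (A *v p) + r \<bullet> (A *v r)"
    using pr rp by (simp add: matrix_vector_right_distrib inner_add)
  then show ?thesis using r by (simp add: norm_wrt_def p_def)
qed

text \<open>Monotonicity of \<open>emeasure\<close> requires the larger set to be
  measurable.\<close>

lemma norm_wrt_ball_measurable:
  fixes A :: "real ^ 'm ^ 'm"
  shows "{z. ereal (norm_wrt A (z - c)) \<le> q} \<in> sets lebesgue"
proof -
  have "continuous_on UNIV (\<lambda>z. ereal (norm_wrt A (z - c)))"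
    unfolding norm_wrt_def
    by (intro continuous_intros
        bounded_linear.continuous_on[OF matrix_vector_mul_bounded_linear])
  then have "closed {z. ereal (norm_wrt A (z - c)) \<le> q}"
    by (rule closed_Collect_le[OF _ continuous_on_const])
  then show ?thesis by simp
qed

lemma emeasure_norm_wrt_ball:
  fixes A :: "real ^ 'm ^ 'm"
  shows "emeasure lebesgue {z. ereal (norm_wrt A (z - c)) \<le> q}
         = emeasure lebesgue {z. ereal (norm_wrt A z) \<le> q}"
proof -
  \<comment> \<open>The translation is written as an affine map of ratio 1 to fit
    \<open>emeasure_lebesgue_affine\<close>.\<close>
  have "{z. ereal (norm_wrt A (z - c)) \<le> q}
        = (\<lambda>z. 1 *\<^sub>R z + c) ` {z. ereal (norm_wrt A z) \<le> q}"
    by (auto simp: image_iff intro!: exI[of _ "_ - c"])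
  then show ?thesis by (simp only: emeasure_lebesgue_affine) simp
qed

text \<open>With different centres the two sets need not be nested; they become so once both are
  moved to the origin.\<close>

lemma emeasure_norm_wrt_ball_mono:
  fixes A :: "real ^ 'm ^ 'm"
  assumes "q \<le> q'"
  shows "emeasure lebesgue {z. ereal (norm_wrt A (z - c)) \<le> q}
         \<le> emeasure lebesgue {z. ereal (norm_wrt A (z - c')) \<le> q'}"
  unfolding emeasure_norm_wrt_ball[of A c] emeasure_norm_wrt_ball[of A c']
  using assms norm_wrt_ball_measurable[of A 0 q']
  by (intro emeasure_mono) (auto intro: order_trans)

text \<open>The identity block lets \<open>v\<close> be read off from the \<open>Inl\<close>
  components of its image.\<close>

lemma inj_hier_matrix: "inj ((*v) (hier_matrix H_sub))"
proof (rule injI)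
  fix v w assume eq: "hier_matrix H_sub *v v = hier_matrix H_sub *v w"
  have "(hier_matrix H_sub *v u) $ Inl j = (mat 1 *v u) $ j" for u j
    by (simp add: hier_matrix_def matrix_vector_mult_def)
  then have "v $ j = w $ j" for j using eq by (metis matrix_vector_mul_lid)
  then show "v = w" by (simp add: vec_eq_iff)
qed

theorem theorem5:
  fixes H_sub :: "real ^ 'n ^ 'k::finite"
    and H :: "real ^ 'n ^ ('n + 'k)"
    and T :: nat
    and D_train D_estim D_calib :: "nat set"
    and x :: "nat \<Rightarrow> real ^ 'd"
    and y :: "nat \<Rightarrow> real ^ ('n + 'k)"
    and \<A> :: "(real ^ 'd, real ^ ('n + 'k)) sample \<Rightarrow> real ^ 'd \<Rightarrow> real ^ ('n + 'k)"
    and \<E> :: "(real ^ 'd, real ^ ('n + 'k)) sample \<Rightarrow> real ^ ('n + 'k) ^ ('n + 'k)"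
    and \<alpha> :: real
  assumes "CARD('n) \<ge> 2"
    and "H = hier_matrix H_sub"
    and "\<And>t. t \<in> {1..T} \<Longrightarrow> coherent H (y t)"
    and "D_train \<union> D_estim \<union> D_calib = {1..T}"
    and "D_train \<inter> D_estim = {}" "D_train \<inter> D_calib = {}" "D_estim \<inter> D_calib = {}"
    and "sym_pos_def (\<E> (sample_on (D_train \<union> D_estim) x y))"
    and "0 < \<alpha>" "\<alpha> < 1"
  shows "\<forall>x'. emeasure lebesgue (hier_ellipsoid H \<A> \<E> \<alpha> D_train D_estim D_calib x y x')
             \<le> emeasure lebesgue (plain_ellipsoid \<A> \<E> \<alpha> D_train D_estim D_calib x y x')"
proof
  fix x'
  define \<mu> where "\<mu> = \<A> (sample_on D_train x y)"
  define A where "A = \<E> (sample_on (D_train \<union> D_estim) x y)"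
  have A: "sym_pos_def A" using assms(8) by (simp add: A_def)
  have inv: "invertible (transpose H ** A ** H)"
    using A assms(2) by (simp add: invertible_gram_if_sym_pos_def inj_hier_matrix)
  have "finite (D_train \<union> D_estim \<union> D_calib)" using assms(4) by simp
  then have fin: "finite D_calib" by simp
  have "norm_wrt A (y t - proj_wrt H A *v \<mu> (x t)) \<le> norm_wrt A (y t - \<mu> (x t))"
    if "t \<in> D_calib" for t
  proof -
    have "coherent H (y t)" using that assms(3,4) by blast
    then have "proj_wrt H A *v y t = y t"
      unfolding coherent_def by (metis proj_wrt_fixes_range[OF inv])
    then have "y t - proj_wrt H A *v \<mu> (x t) = proj_wrt H A *v (y t - \<mu> (x t))"
      by (simp add: matrix_vector_mult_diff_distrib)
    then show ?thesis using norm_wrt_proj_wrt_le[OF A inv] by metis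
  qed
  then show "emeasure lebesgue (hier_ellipsoid H \<A> \<E> \<alpha> D_train D_estim D_calib x y x')
             \<le> emeasure lebesgue (plain_ellipsoid \<A> \<E> \<alpha> D_train D_estim D_calib x y x')"
    unfolding hier_ellipsoid_def plain_ellipsoid_def calibrated_ellipsoid_def Let_def
      \<mu>_def[symmetric] A_def[symmetric]
    \<comment> \<open>Both ellipsoids use the same \<open>A\<close>, so only their radii remain to
      be compared, through the calibration scores.\<close>
    by (intro emeasure_norm_wrt_ball_mono conformal_quantile_mono fin)
qed

end
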